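(* Let $f$, $\mathbf{C}$, $\mathbf{d}$, $\mathbf{P}$ and $\rho>0$ be as in the context and assume $\mathbf{T}_1=\mathbf{C}\,\partial f^*(\mathbf{C}^T\,\cdot)-\mathbf{d}$ is maximal monotone. Let $\boldsymbol{\lambda}^{(0)}\in\mathbb{R}^{M_E}$, $\mathbf{x}^{(0)}\in\mathbb{R}^{M_V}$ and let $(\mathbf{x}^{(k)},\boldsymbol{\lambda}^{(k)})_{k\ge1}$ be generated by the simplified PDMM algorithm: for $k\ge0$, $$\mathbf{x}^{(k+1)}\in\arg\min_{\mathbf{x}}\Big(f(\mathbf{x})-\langle\mathbf{C}^T\mathbf{P}\boldsymbol{\lambda}^{(k)},\mathbf{x}\rangle+\frac{\rho}{2}\|\mathbf{C}\mathbf{x}+\mathbf{P}\mathbf{C}\mathbf{x}^{(k)}-2\mathbf{d}\|^2\Big),$$ $$\boldsymbol{\lambda}^{(k+1)}=\mathbf{P}\boldsymbol{\lambda}^{(k)}-\rho\big(\mathbf{C}\mathbf{x}^{(k+1)}+\mathbf{P}\mathbf{C}\mathbf{x}^{(k)}-2\mathbf{d}\big).$$ Then this algorithm is equivalent to the fixed-point iteration of the Peaceman-Rachford splitting of the extended dual problem: setting $\mathbf{z}^{(k)}=\mathbf{P}\big(\boldsymbol{\lambda}^{(k)}-\rho(\mathbf{C}\mathbf{x}^{(k)}-\mathbf{d})\big)$ for $k\ge0$, one has for all $k\ge0$ $$\mathbf{z}^{(k+1)}=\mathbf{R}_{\mathbf{T}_2,\rho}\circ\mathbf{R}_{\mathbf{T}_1,\rho}(\mathbf{z}^{(k)}),\qquad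 \boldsymbol{\lambda}^{(k+1)}=\mathbf{J}_{\mathbf{T}_1,\rho}(\mathbf{z}^{(k)}).$$
   Context: For an operator $\mathbf{T}$, $\mathbf{J}_{\mathbf{T},\rho}=(\mathbf{I}+\rho\mathbf{T})^{-1}$ is its resolvent and $\mathbf{R}_{\mathbf{T},\rho}=2\mathbf{J}_{\mathbf{T},\rho}-\mathbf{I}$ its reflected resolvent. $\Gamma_0(\mathbb{R}^n)$ is the set of closed, convex, proper functions $\mathbb{R}^n\to\mathbb{R}\cup\{+\infty\}$; $f^*$ is the Fenchel conjugate. Network setting: $\mathbf{G}(V,E)$ is an undirected graph with nodes $V=\{1,\dots,N\}$ and neighbour sets $\mathcal{N}(i)=\{j:(i,j)\in E\}$. Node $i$ has $f_i\in\Gamma_0(\mathbb{R}^{M_i})$. For each edge $(i,j)\in E$ there are matrices $\mathbf{A}_{i|j}\in\mathbb{R}^{M_{ij}\times M_i}$, $\mathbf{A}_{j|i}\in\mathbb{R}^{M_{ij}\times M_j}$ and a vector $\mathbf{b}_{ij}=\mathbf{b}_{ji}\in\mathbb{R}^{M_{ij}}$ (with $M_{ij}=M_{ji}$). The primal problem is $\min\sum_{i}f_i(\mathbf{x}_i)$ subject to $\mathbf{A}_{i|j}\mathbf{x}_i+\mathbf{A}_{j|i}\mathbf{x}_j=\mathbf{b}_{ij}$ for all $(i,j)\in E$. Set $M_V=\sum_iM_i$ and $f(\mathbf{x})=\sum_if_i(\mathbf{x}_i)$. Let $M_E=\sum_{i\in V}\sum_{j\in\mathcal{N}(i)}M_{ij}$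 (sum over directed edges $i|j$), and index vectors in $\mathbb{R}^{M_E}$ by blocks $\boldsymbol{\lambda}_{i|j}\in\mathbb{R}^{M_{ij}}$, ordered first by $i$, then by $j$. $\mathbf{C}\in\mathbb{R}^{M_E\times M_V}$ is block diagonal with blocks $\mathbf{C}_i$, where $\mathbf{C}_i$ stacks vertically $\mathbf{A}_{i|j}$, $j\in\mathcal{N}(i)$; so $(\mathbf{C}\mathbf{x})_{i|j}=\mathbf{A}_{i|j}\mathbf{x}_i$. $\mathbf{d}\in\mathbb{R}^{M_E}$ has blocks $\mathbf{d}_{i|j}=\tfrac12\mathbf{b}_{ij}$. $\mathbf{P}$ is the symmetric permutation matrix with $(\mathbf{P}\boldsymbol{\lambda})_{i|j}=\boldsymbol{\lambda}_{j|i}$ (so $\mathbf{P}^2=\mathbf{I}$, $\mathbf{P}\mathbf{d}=\mathbf{d}$). The extended dual problem is $\min_{\boldsymbol{\lambda}}f^*(\mathbf{C}^T\boldsymbol{\lambda})-\mathbf{d}^T\boldsymbol{\lambda}+\iota_{\ker(\mathbf{I}-\mathbf{P})}(\boldsymbol{\lambda})$, where $\iota_S$ is the indicator function of $S$ ($0$ on $S$, $+\infty$ elsewhere); $\mathbf{T}_2=\partial\iota_{\ker(\mathbf{I}-\mathbf{P})}$ is the corresponding normal cone operator. *)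

theory Defs
  imports
    "HOL-Library.Extended_Real"
    "HOL-Analysis.Function_Topology"
    "Jordan_Normal_Form.Matrix_Kernel"
begin

section \<open>Convex analysis on \<open>carrier_vec n\<close>\<close>

definition vnorm :: "real vec \<Rightarrow> real" where
  "vnorm v = sqrt (v \<bullet> v)"

definition proper_fun :: "nat \<Rightarrow> (real vec \<Rightarrow> ereal) \<Rightarrow> bool" where
  "proper_fun n g \<longleftrightarrow>
     (\<forall>x\<in>carrier_vec n. g x \<noteq> -\<infinity>) \<and> (\<exists>x\<in>carrier_vec n. g x \<noteq> \<infinity>)"

definition convex_fun :: "nat \<Rightarrow> (real vec \<Rightarrow> ereal) \<Rightarrow> bool" where
  "convex_fun n g \<longleftrightarrow>
     (\<forall>x\<in>carrier_vec n. \<forall>y\<in>carrier_vec n. \<forall>t::real. 0 < t \<and> t < 1 \<longrightarrow>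
        g ((1 - t) \<cdot>\<^sub>v x + t \<cdot>\<^sub>v y) \<le> ereal (1 - t) * g x + ereal t * g y)"

text \<open>
  A function is closed if its epigraph is. The type of vectors carries no topology, so the
  epigraph is pulled back along \<open>u \<mapsto> vec n u\<close> to \<open>(nat \<Rightarrow> real) \<times> real\<close> with the product topology.
  As this map only reads the coordinates below \<open>n\<close>, the pull-back is closed iff the epigraph is
  closed in the Euclidean topology.
\<close>

definition closed_fun :: "nat \<Rightarrow> (real vec \<Rightarrow> ereal) \<Rightarrow> bool" where
  "closed_fun n g \<longleftrightarrow> closed {(u :: nat \<Rightarrow> real, r :: real). g (vec n u) \<le> ereal r}"

definition Gamma0 :: "nat \<Rightarrow> (real vec \<Rightarrow> ereal) set" where
  "Gamma0 n = {g. closed_fun n g \<and> convex_fun n g \<and> proper_fun n g}"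

definition fenchel_conj :: "nat \<Rightarrow> (real vec \<Rightarrow> ereal) \<Rightarrow> real vec \<Rightarrow> ereal" where
  "fenchel_conj n g u = (SUP x\<in>carrier_vec n. ereal (u \<bullet> x) - g x)"

definition indicator_fun :: "real vec set \<Rightarrow> real vec \<Rightarrow> ereal" where
  "indicator_fun S x = (if x \<in> S then 0 else \<infinity>)"

section \<open>Set-valued operators, represented by their graphs\<close>

type_synonym operator = "(real vec \<times> real vec) set"

definition subdiff :: "nat \<Rightarrow> (real vec \<Rightarrow> ereal) \<Rightarrow> operator" where
  "subdiff n g = {(x, u). x \<in> carrier_vec n \<and> u \<in> carrier_vec n \<and> \<bar>g x\<bar> \<noteq> \<infinity> \<and>
     (\<forall>y\<in>carrier_vec n. g x + ereal (u \<bullet> (y - x)) \<le> g y)}"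

definition monotone_op :: "nat \<Rightarrow> operator \<Rightarrow> bool" where
  "monotone_op n T \<longleftrightarrow> T \<subseteq> carrier_vec n \<times> carrier_vec n \<and>
     (\<forall>(x, u)\<in>T. \<forall>(y, v)\<in>T. 0 \<le> (u - v) \<bullet> (x - y))"

definition maximal_monotone :: "nat \<Rightarrow> operator \<Rightarrow> bool" where
  "maximal_monotone n T \<longleftrightarrow> monotone_op n T \<and> (\<forall>S. monotone_op n S \<and> T \<subseteq> S \<longrightarrow> S = T)"

definition resolvent :: "operator \<Rightarrow> real \<Rightarrow> operator" where
  "resolvent T \<rho> = {(x, x + \<rho> \<cdot>\<^sub>v u) | x u. (x, u) \<in> T}\<inverse>"

definition reflected_resolvent :: "operator \<Rightarrow> real \<Rightarrow> operator" where
  "reflected_resolvent T \<rho> = {(z, 2 \<cdot>\<^sub>v y - z) | z y. (z, y) \<in> resolvent T \<rho>}"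

section \<open>The network\<close>

text \<open>
  The nodes are \<open>{1..N}\<close> and \<open>E\<close> is the symmetric set of directed edges; node \<open>i\<close> has dimension
  \<open>M i\<close> and edge \<open>(i, j)\<close> has dimension \<open>Me i j\<close>.

  The lists \<open>node_coords\<close> and \<open>edge_coords\<close> name the coordinates of the stacked vectors: coordinate
  number \<open>r\<close> is component \<open>m\<close> of block \<open>i\<close> (of block \<open>i|j\<close>) iff the \<open>r\<close>-th list entry is
  \<open>(i, m)\<close> (is \<open>(i, j, m)\<close>). Components are counted from 0.
\<close>

definition dim_V :: "nat \<Rightarrow> (nat \<Rightarrow> nat) \<Rightarrow> nat" where
  "dim_V N M = (\<Sum>i\<in>{1..N}. M i)"

definition neighbours :: "(nat \<times> nat) set \<Rightarrow> nat \<Rightarrow> nat set" where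
  "neighbours E i = {j. (i, j) \<in> E}"

definition dim_E :: "nat \<Rightarrow> (nat \<times> nat) set \<Rightarrow> (nat \<Rightarrow> nat \<Rightarrow> nat) \<Rightarrow> nat" where
  "dim_E N E Me = (\<Sum>i\<in>{1..N}. \<Sum>j\<in>neighbours E i. Me i j)"

definition node_coords :: "nat \<Rightarrow> (nat \<Rightarrow> nat) \<Rightarrow> (nat \<times> nat) list" where
  "node_coords N M = [(i, m). i \<leftarrow> [1..<Suc N], m \<leftarrow> [0..<M i]]"

definition edge_coords ::
  "nat \<Rightarrow> (nat \<times> nat) set \<Rightarrow> (nat \<Rightarrow> nat \<Rightarrow> nat) \<Rightarrow> (nat \<times> nat \<times> nat) list" where
  "edge_coords N E Me =
     [(i, j, m). i \<leftarrow> [1..<Suc N], j \<leftarrow> [1..<Suc N], (i, j) \<in> E, m \<leftarrow> [0..<Me i j]]"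

definition position :: "'a list \<Rightarrow> 'a \<Rightarrow> nat" where
  "position cs c = (THE r. r < length cs \<and> cs ! r = c)"

definition node_block :: "nat \<Rightarrow> (nat \<Rightarrow> nat) \<Rightarrow> real vec \<Rightarrow> nat \<Rightarrow> real vec" where
  "node_block N M x i = vec (M i) (\<lambda>m. x $ position (node_coords N M) (i, m))"

definition edge_block ::
  "nat \<Rightarrow> (nat \<times> nat) set \<Rightarrow> (nat \<Rightarrow> nat \<Rightarrow> nat) \<Rightarrow> real vec \<Rightarrow> nat \<Rightarrow> nat \<Rightarrow> real vec" where
  "edge_block N E Me l i j = vec (Me i j) (\<lambda>m. l $ position (edge_coords N E Me) (i, j, m))"

definition network_fun ::
  "nat \<Rightarrow> (nat \<Rightarrow> nat) \<Rightarrow> (nat \<Rightarrow> real vec \<Rightarrow> ereal) \<Rightarrow> real vec \<Rightarrow> ereal" where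
  "network_fun N M f x = (\<Sum>i\<in>{1..N}. f i (node_block N M x i))"

definition C_mat ::
  "nat \<Rightarrow> (nat \<times> nat) set \<Rightarrow> (nat \<Rightarrow> nat) \<Rightarrow> (nat \<Rightarrow> nat \<Rightarrow> nat) \<Rightarrow> (nat \<Rightarrow> nat \<Rightarrow> real mat) \<Rightarrow> real mat" where
  "C_mat N E M Me A = mat (dim_E N E Me) (dim_V N M) (\<lambda>(r, c).
     case (edge_coords N E Me ! r, node_coords N M ! c) of
       ((i, j, m), (i', n)) \<Rightarrow> if i' = i then A i j $$ (m, n) else 0)"

definition d_vec ::
  "nat \<Rightarrow> (nat \<times> nat) set \<Rightarrow> (nat \<Rightarrow> nat \<Rightarrow> nat) \<Rightarrow> (nat \<Rightarrow> nat \<Rightarrow> real vec) \<Rightarrow> real vec" where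
  "d_vec N E Me b = vec (dim_E N E Me) (\<lambda>r.
     case edge_coords N E Me ! r of (i, j, m) \<Rightarrow> (1/2) * b i j $ m)"

definition P_mat ::
  "nat \<Rightarrow> (nat \<times> nat) set \<Rightarrow> (nat \<Rightarrow> nat \<Rightarrow> nat) \<Rightarrow> real mat" where
  "P_mat N E Me = mat (dim_E N E Me) (dim_E N E Me) (\<lambda>(r, c).
     case (edge_coords N E Me ! r, edge_coords N E Me ! c) of
       ((i, j, m), (i', j', m')) \<Rightarrow> if i' = j \<and> j' = i \<and> m' = m then 1 else 0)"

text \<open>The operators \<open>C \<partial>f\<^sup>*(C\<^sup>T \<cdot>) - d\<close> and \<open>\<partial>\<iota>\<^bsub>ker(I - P)\<^esub>\<close>.\<close>

definition T1_op :: "(real vec \<Rightarrow> ereal) \<Rightarrow> real mat \<Rightarrow> real vec \<Rightarrow> operator" where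
  "T1_op g C d = {(l, C *\<^sub>v x - d) | l x. l \<in> carrier_vec (dim_row C) \<and>
     (C\<^sup>T *\<^sub>v l, x) \<in> subdiff (dim_col C) (fenchel_conj (dim_col C) g)}"

definition T2_op :: "real mat \<Rightarrow> operator" where
  "T2_op P = subdiff (dim_row P) (indicator_fun (mat_kernel (1\<^sub>m (dim_row P) - P)))"

section \<open>Block structure of the stacked objects\<close>

lemma distinct_node_coords: "distinct (node_coords N M)"
proof -
  have "node_coords N M = concat (map (\<lambda>i. map (Pair i) [0..<M i]) [1..<Suc N])"
    by (simp add: node_coords_def)
  moreover have "distinct (concat (map (\<lambda>i. map (Pair i) [0..<M i]) xs))" if "distinct xs" for xs
    using that by (induction xs) (auto simp: distinct_map inj_on_def)
  ultimately show ?thesis by simp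
qed

lemma set_node_coords: "set (node_coords N M) = {(i, m). i \<in> {1..N} \<and> m < M i}"
  by (auto simp: node_coords_def)

lemma length_node_coords: "length (node_coords N M) = dim_V N M"
proof -
  have "set (node_coords N M) = Sigma {1..N} (\<lambda>i. {..<M i})"
    by (auto simp: set_node_coords)
  then show ?thesis
    using distinct_card[OF distinct_node_coords, of N M] by (simp add: dim_V_def)
qed

lemma set_edge_coords:
  assumes "E \<subseteq> {1..N} \<times> {1..N}"
  shows "set (edge_coords N E Me) = {(i, j, m). (i, j) \<in> E \<and> m < Me i j}"
proof -
  have "set (edge_coords N E Me) =
      {(i, j, m). i \<in> {1..<Suc N} \<and> j \<in> {1..<Suc N} \<and> (i, j) \<in> E \<and> m < Me i j}"
    unfolding edge_coords_def by (force simp del: upt_Suc split: if_splits)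
  also have "\<dots> = {(i, j, m). (i, j) \<in> E \<and> m < Me i j}"
    using assms by fastforce
  finally show ?thesis .
qed

lemma distinct_edge_coords: "distinct (edge_coords N E Me)"
proof -
  let ?g = "\<lambda>i j. if (i, j) \<in> E then map (\<lambda>m. (i, j, m)) [0..<Me i j] else []"
  have inner: "distinct (concat (map (?g i) ys))" if "distinct ys" for i ys
    using that by (induction ys) (auto simp: distinct_map inj_on_def)
  have "distinct (concat (map (\<lambda>i. concat (map (?g i) ys)) xs))"
    if "distinct xs" "distinct ys" for xs ys
    using that inner by (induction xs) (auto split: if_splits)
  from this[of "[1..<Suc N]" "[1..<Suc N]"] show ?thesis
    by (simp add: edge_coords_def)
qed

lemma length_edge_coords:
  assumes "E \<subseteq> {1..N} \<times> {1..N}"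
  shows "length (edge_coords N E Me) = dim_E N E Me"
proof -
  have fin: "finite (neighbours E i)" for i
    by (rule finite_subset[of _ "{1..N}"]) (use assms in \<open>auto simp: neighbours_def\<close>)
  have "set (edge_coords N E Me) = Sigma {1..N} (\<lambda>i. Sigma (neighbours E i) (\<lambda>j. {..<Me i j}))"
    using assms by (auto simp: set_edge_coords[OF assms] neighbours_def)
  then show ?thesis
    using distinct_card[OF distinct_edge_coords, of N E Me] fin by (simp add: dim_E_def)
qed

lemma position_props:
  assumes "distinct cs" "c \<in> set cs"
  shows "position cs c < length cs" "cs ! position cs c = c"
proof -
  from assms have "\<exists>!r. r < length cs \<and> cs ! r = c"
    by (metis distinct_Ex1)
  from theI'[OF this] show "position cs c < length cs" "cs ! position cs c = c"
    by (auto simp: position_def)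
qed

lemma position_nth:
  assumes "distinct cs" "r < length cs"
  shows "position cs (cs ! r) = r"
  using position_props[OF assms(1), of "cs ! r"] assms by (metis nth_eq_iff_index_eq nth_mem)

lemma sum_over_coords:
  assumes "distinct cs"
  shows "(\<Sum>r\<in>{0..<length cs}. g r) = (\<Sum>c\<in>set cs. g (position cs c))"
  by (rule sum.reindex_bij_witness[of _ "position cs" "\<lambda>r. cs ! r"])
     (simp_all add: assms position_props position_nth)

lemma edge_block_C_mat:
  assumes E: "E \<subseteq> {1..N} \<times> {1..N}" and ij: "(i, j) \<in> E"
    and A: "A i j \<in> carrier_mat (Me i j) (M i)" and x: "x \<in> carrier_vec (dim_V N M)"
  shows "edge_block N E Me (C_mat N E M Me A *\<^sub>v x) i j = A i j *\<^sub>v node_block N M x i"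
proof (rule eq_vecI)
  fix m assume "m < dim_vec (A i j *\<^sub>v node_block N M x i)"
  then have m: "m < Me i j" using A by simp
  let ?ec = "edge_coords N E Me" and ?nc = "node_coords N M"
  have mem: "(i, j, m) \<in> set ?ec" using m ij by (simp add: set_edge_coords[OF E])
  have r: "position ?ec (i, j, m) < dim_E N E Me" "?ec ! position ?ec (i, j, m) = (i, j, m)"
    using position_props[OF distinct_edge_coords mem] by (simp_all add: length_edge_coords[OF E])
  have i: "i \<in> {1..N}" using E ij by auto
  have "(C_mat N E M Me A *\<^sub>v x) $ position ?ec (i, j, m) =
      (\<Sum>c\<in>{0..<dim_V N M}. (case ?nc ! c of (i', n) \<Rightarrow> if i' = i then A i j $$ (m, n) else 0) * x $ c)"
    using r x by (auto simp: C_mat_def scalar_prod_def intro!: sum.cong)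
  also have "\<dots> = (\<Sum>c\<in>set ?nc. (case ?nc ! position ?nc c of
      (i', n) \<Rightarrow> if i' = i then A i j $$ (m, n) else 0) * x $ position ?nc c)"
    unfolding length_node_coords[symmetric] by (rule sum_over_coords[OF distinct_node_coords])
  also have "\<dots> = (\<Sum>c\<in>set ?nc. (case c of
      (i', n) \<Rightarrow> if i' = i then A i j $$ (m, n) else 0) * x $ position ?nc c)"
    by (intro sum.cong) (simp_all add: position_props[OF distinct_node_coords])
  also have "\<dots> = (\<Sum>c\<in>Pair i ` {0..<M i}. (case c of
      (i', n) \<Rightarrow> if i' = i then A i j $$ (m, n) else 0) * x $ position ?nc c)"
  proof (rule sum.mono_neutral_right[OF finite_set])
    show "Pair i ` {0..<M i} \<subseteq> set ?nc" using i by (auto simp: set_node_coords)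
  qed (auto simp: set_node_coords)
  also have "\<dots> = (\<Sum>n\<in>{0..<M i}. A i j $$ (m, n) * x $ position ?nc (i, n))"
    by (subst sum.reindex) (auto simp: inj_on_def)
  also have "\<dots> = (A i j *\<^sub>v node_block N M x i) $ m"
    using A m by (auto simp: scalar_prod_def node_block_def intro!: sum.cong)
  finally show "edge_block N E Me (C_mat N E M Me A *\<^sub>v x) i j $ m = (A i j *\<^sub>v node_block N M x i) $ m"
    using m by (simp add: edge_block_def)
qed (use A in \<open>simp add: edge_block_def\<close>)

lemma edge_block_d_vec:
  assumes E: "E \<subseteq> {1..N} \<times> {1..N}" and ij: "(i, j) \<in> E" and b: "b i j \<in> carrier_vec (Me i j)"
  shows "edge_block N E Me (d_vec N E Me b) i j = (1/2) \<cdot>\<^sub>v b i j"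
proof (rule eq_vecI)
  fix m assume "m < dim_vec ((1/2) \<cdot>\<^sub>v b i j)"
  then have m: "m < Me i j" using b by simp
  then have mem: "(i, j, m) \<in> set (edge_coords N E Me)" using ij by (simp add: set_edge_coords[OF E])
  show "edge_block N E Me (d_vec N E Me b) i j $ m = ((1/2) \<cdot>\<^sub>v b i j) $ m"
    using position_props[OF distinct_edge_coords mem] m b
    by (simp add: edge_block_def d_vec_def length_edge_coords[OF E])
qed (use b in \<open>simp add: edge_block_def\<close>)

lemma edge_block_P_mat:
  assumes E: "E \<subseteq> {1..N} \<times> {1..N}" and ij: "(i, j) \<in> E" "(j, i) \<in> E" and Me: "Me i j = Me j i"
    and l: "l \<in> carrier_vec (dim_E N E Me)"
  shows "edge_block N E Me (P_mat N E Me *\<^sub>v l) i j = edge_block N E Me l j i"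
proof (rule eq_vecI)
  fix m assume "m < dim_vec (edge_block N E Me l j i)"
  then have m: "m < Me i j" "m < Me j i" using Me by (simp_all add: edge_block_def)
  let ?ec = "edge_coords N E Me"
  have mem: "(i, j, m) \<in> set ?ec" "(j, i, m) \<in> set ?ec"
    using m ij by (simp_all add: set_edge_coords[OF E])
  have r: "position ?ec (i, j, m) < dim_E N E Me" "?ec ! position ?ec (i, j, m) = (i, j, m)"
    using position_props[OF distinct_edge_coords mem(1)] by (simp_all add: length_edge_coords[OF E])
  have "(P_mat N E Me *\<^sub>v l) $ position ?ec (i, j, m) =
      (\<Sum>c\<in>{0..<dim_E N E Me}. (if ?ec ! c = (j, i, m) then 1 else 0) * l $ c)"
    using r l by (auto simp: P_mat_def scalar_prod_def intro!: sum.cong split: prod.splits)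
  also have "\<dots> = (\<Sum>c\<in>set ?ec. (if ?ec ! position ?ec c = (j, i, m) then 1 else 0) * l $ position ?ec c)"
    unfolding length_edge_coords[OF E, symmetric] by (rule sum_over_coords[OF distinct_edge_coords])
  also have "\<dots> = (\<Sum>c\<in>set ?ec. if c = (j, i, m) then l $ position ?ec c else 0)"
    by (intro sum.cong) (simp_all add: position_props[OF distinct_edge_coords])
  also have "\<dots> = l $ position ?ec (j, i, m)"
    using mem by simp
  finally show "edge_block N E Me (P_mat N E Me *\<^sub>v l) i j $ m = edge_block N E Me l j i $ m"
    using m by (simp add: edge_block_def)
qed (use Me in \<open>simp add: edge_block_def\<close>)

end

theory Submission
  imports Defs
begin

text \<open>
  The optimality condition of the \<open>x\<close>-update says that \<open>C\<^sup>T \<lambda>\<^sup>k\<^sup>+\<^sup>1\<close> is a subgradient of \<open>f\<close> at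
  \<open>x\<^sup>k\<^sup>+\<^sup>1\<close>. By the easy half of Fenchel duality \<open>x\<^sup>k\<^sup>+\<^sup>1\<close> is then a subgradient of \<open>f\<^sup>*\<close> at
  \<open>C\<^sup>T \<lambda>\<^sup>k\<^sup>+\<^sup>1\<close>, so \<open>C x\<^sup>k\<^sup>+\<^sup>1 - d\<close> is a value of \<open>T\<^sub>1\<close> at \<open>\<lambda>\<^sup>k\<^sup>+\<^sup>1\<close>; and since \<open>P d = d\<close>, the
  \<open>\<lambda>\<close>-update reads \<open>\<lambda>\<^sup>k\<^sup>+\<^sup>1 + \<rho> (C x\<^sup>k\<^sup>+\<^sup>1 - d) = z\<^sup>k\<close>. Resolvents of monotone operators are
  single-valued, so \<open>\<lambda>\<^sup>k\<^sup>+\<^sup>1\<close> is the resolvent of \<open>T\<^sub>1\<close> at \<open>z\<^sup>k\<close>, and the reflected resolvent is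
  \<open>\<lambda>\<^sup>k\<^sup>+\<^sup>1 - \<rho> (C x\<^sup>k\<^sup>+\<^sup>1 - d)\<close>. Finally, \<open>P\<close> is a symmetric involution, so the resolvent of \<open>T\<^sub>2\<close>,
  the orthogonal projection onto \<open>ker (I - P)\<close>, is \<open>(I + P) / 2\<close>, and its reflection is \<open>P\<close>.
\<close>

section \<open>Subdifferentials and resolvents\<close>

text \<open>Adding the two subgradient inequalities cancels the function values, which are finite by
  the definition of \<open>subdiff\<close>.\<close>

lemma monotone_op_subdiff: "monotone_op n (subdiff n g)"
proof -
  have "0 \<le> (u - v) \<bullet> (x - y)"
    if xu: "(x, u) \<in> subdiff n g" and yv: "(y, v) \<in> subdiff n g" for x u y v
  proof -
    have c: "x \<in> carrier_vec n" "u \<in> carrier_vec n" "y \<in> carrier_vec n" "v \<in> carrier_vec n"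
      using xu yv by (auto simp: subdiff_def)
    obtain a b where ab: "g x = ereal a" "g y = ereal b"
      using xu yv by (auto simp: subdiff_def)
    have "a + u \<bullet> (y - x) \<le> b" "b + v \<bullet> (x - y) \<le> a"
      using xu yv c ab by (fastforce simp: subdiff_def)+
    then show ?thesis
      using c by (simp add: minus_scalar_prod_distrib scalar_prod_minus_distrib)
  qed
  then show ?thesis by (auto simp: monotone_op_def subdiff_def)
qed

text \<open>Subtracting the two decompositions of \<open>z\<close> gives
  \<open>a - b = -\<rho> (u - v)\<close>. Monotonicity then makes \<open>-\<rho>\<close> times the
  squared norm of \<open>u - v\<close> nonnegative, forcing \<open>u = v\<close> and hence
  \<open>a = b\<close>.\<close>

lemma resolvent_unique:
  assumes "monotone_op n T" "\<rho> > 0" "(z, a) \<in> resolvent T \<rho>" "(z, b) \<in> resolvent T \<rho>"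
  shows "a = b"
proof -
  obtain u v where T: "(a, u) \<in> T" "(b, v) \<in> T" and z: "z = a + \<rho> \<cdot>\<^sub>v u" "z = b + \<rho> \<cdot>\<^sub>v v"
    using assms(3,4) by (auto simp: resolvent_def)
  have c: "a \<in> carrier_vec n" "u \<in> carrier_vec n" "b \<in> carrier_vec n" "v \<in> carrier_vec n"
    using T assms(1) by (auto simp: monotone_op_def)
  have mono: "0 \<le> (u - v) \<bullet> (a - b)"
    using T assms(1) by (fastforce simp: monotone_op_def)
  have ab: "a - b = (- \<rho>) \<cdot>\<^sub>v (u - v)"
  proof (rule eq_vecI)
    fix i assume "i < dim_vec ((- \<rho>) \<cdot>\<^sub>v (u - v))"
    then have i: "i < n" using c by simp
    have "(a + \<rho> \<cdot>\<^sub>v u) $ i = (b + \<rho> \<cdot>\<^sub>v v) $ i" using z by simp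
    then show "(a - b) $ i = ((- \<rho>) \<cdot>\<^sub>v (u - v)) $ i"
      using i c by (simp add: algebra_simps)
  qed (use c in simp)
  have "0 \<le> - \<rho> * ((u - v) \<bullet> (u - v))"
    using mono c unfolding ab by simp
  then have "(u - v) \<bullet> (u - v) \<le> 0"
    using \<open>\<rho> > 0\<close> by (simp add: mult_le_0_iff)
  moreover have "(u - v) \<bullet> (u - v) \<ge> 0"
    by (simp add: scalar_prod_def sum_nonneg)
  ultimately have "(\<Sum>i\<in>{0..<n}. (u - v) $ i * (u - v) $ i) = 0"
    using c by (simp add: scalar_prod_def)
  then have "\<forall>i\<in>{0..<n}. (u - v) $ i * (u - v) $ i = 0"
    by (subst (asm) sum_nonneg_eq_0_iff) auto
  then have "u $ i = v $ i" if "i < n" for i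
    using that c by simp
  then have "u = v" using c by (intro eq_vecI) auto
  with ab c have "a - b = 0\<^sub>v n" by auto
  then have "(a - b) $ i = 0" if "i < n" for i using that by simp
  then show ?thesis using c by (intro eq_vecI) auto
qed

lemma reflected_resolvent_Image:
  "reflected_resolvent T \<rho> `` {z} = (\<lambda>y. 2 \<cdot>\<^sub>v y - z) ` (resolvent T \<rho> `` {z})"
  by (auto simp: reflected_resolvent_def)

text \<open>The subgradient inequality says that \<open>x\<close> attains the supremum defining the
  conjugate at \<open>u\<close>. The same term, evaluated at any other \<open>v\<close>, is a lower
  bound affine in \<open>v\<close> with slope \<open>x\<close>.\<close>

lemma subdiff_fenchel_conj:
  assumes "(x, u) \<in> subdiff n g"
  shows "(u, x) \<in> subdiff n (fenchel_conj n g)"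
proof -
  have c: "x \<in> carrier_vec n" "u \<in> carrier_vec n"
    and sub: "\<And>y. y \<in> carrier_vec n \<Longrightarrow> g x + ereal (u \<bullet> (y - x)) \<le> g y"
    using assms by (auto simp: subdiff_def)
  obtain a where a: "g x = ereal a"
    using assms by (auto simp: subdiff_def)
  have ge: "ereal (v \<bullet> x - a) \<le> fenchel_conj n g v" for v
    unfolding fenchel_conj_def by (rule SUP_upper2[OF c(1)]) (simp add: a)
  have "fenchel_conj n g u \<le> ereal (u \<bullet> x - a)"
    unfolding fenchel_conj_def
  proof (rule SUP_least)
    fix y :: "real vec" assume y: "y \<in> carrier_vec n"
    then show "ereal (u \<bullet> y) - g y \<le> ereal (u \<bullet> x - a)"
      using sub[OF y] c by (cases "g y") (auto simp: a scalar_prod_minus_distrib)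
  qed
  then have eq: "fenchel_conj n g u = ereal (u \<bullet> x - a)"
    using ge by (intro antisym)
  have "fenchel_conj n g u + ereal (x \<bullet> (v - u)) \<le> fenchel_conj n g v"
    if v: "v \<in> carrier_vec n" for v
  proof -
    have "x \<bullet> (v - u) = v \<bullet> x - u \<bullet> x"
      using c v by (simp add: scalar_prod_minus_distrib comm_scalar_prod[of x n])
    then show ?thesis using ge[of v] by (simp add: eq)
  qed
  then show ?thesis using c eq by (simp add: subdiff_def)
qed

section \<open>Optimality condition of the \<open>x\<close>-update, and reflection in
  \<open>ker(I - P)\<close>\<close>

lemma vnorm_sq: "(vnorm v)\<^sup>2 = v \<bullet> v"
  by (simp add: vnorm_def scalar_prod_def sum_nonneg)

text \<open>Letting \<open>t\<close> tend to 0 from the right; this discards the second-order term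
  when a minimiser is compared with nearby points.\<close>

lemma le_of_le_add_small_mult:
  fixes a b c :: real
  assumes "\<And>t. 0 < t \<Longrightarrow> t < 1 \<Longrightarrow> a \<le> b + t * c"
  shows "a \<le> b"
proof (rule tendsto_lowerbound)
  show "((\<lambda>t. b + t * c) \<longlongrightarrow> b) (at_right 0)"
    by (auto intro!: tendsto_eq_intros)
  show "\<forall>\<^sub>F t in at_right 0. a \<le> b + t * c"
    using eventually_at_right_real[of 0 1] by (auto elim: eventually_mono intro: assms)
qed simp

text \<open>A first-order condition obtained directly: the minimiser is compared with the points
  \<open>(1 - t) x + t y\<close>, convexity bounds \<open>g\<close> along the segment, the quadratic
  term is expanded exactly, and dividing by \<open>t\<close> and letting \<open>t\<close> tend to 0
  leaves the subgradient inequality.\<close>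

lemma subdiff_of_penalised_arg_min:
  assumes proper: "proper_fun n g" and convex: "convex_fun n g"
    and C: "C \<in> carrier_mat m n" and s: "s \<in> carrier_vec m" and q: "q \<in> carrier_vec m"
    and min: "is_arg_min
      (\<lambda>y. g y - ereal ((C\<^sup>T *\<^sub>v s) \<bullet> y) + ereal (\<rho> / 2 * (vnorm (C *\<^sub>v y + q))\<^sup>2))
      (\<lambda>y. y \<in> carrier_vec n) x"
  shows "(x, C\<^sup>T *\<^sub>v (s - \<rho> \<cdot>\<^sub>v (C *\<^sub>v x + q))) \<in> subdiff n g"
proof -
  define h where "h y = - ((C\<^sup>T *\<^sub>v s) \<bullet> y) + \<rho> / 2 * (vnorm (C *\<^sub>v y + q))\<^sup>2" for y
  have x: "x \<in> carrier_vec n" using min by (simp add: is_arg_min_def)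
  have obj: "g y - ereal ((C\<^sup>T *\<^sub>v s) \<bullet> y) + ereal (\<rho> / 2 * (vnorm (C *\<^sub>v y + q))\<^sup>2) = g y + ereal (h y)" for y
    by (cases "g y") (auto simp: h_def)
  have le: "g x + ereal (h x) \<le> g y + ereal (h y)" if "y \<in> carrier_vec n" for y
    using min that unfolding is_arg_min_def obj by (auto simp: not_less)
  obtain y0 where y0: "y0 \<in> carrier_vec n" "g y0 \<noteq> \<infinity>" "g y0 \<noteq> -\<infinity>" "g x \<noteq> -\<infinity>"
    using proper x by (auto simp: proper_fun_def)
  \<comment> \<open>Comparison with a point where \<open>g\<close> is finite rules out
    \<open>g x = \<infinity>\<close>.\<close>
  obtain a where a: "g x = ereal a"
    using le[OF y0(1)] y0 by (cases "g x"; cases "g y0") auto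
  let ?u = "C\<^sup>T *\<^sub>v (s - \<rho> \<cdot>\<^sub>v (C *\<^sub>v x + q))"
  have u: "?u \<in> carrier_vec n" using C by (intro carrier_vecI) simp
  have "g x + ereal (?u \<bullet> (y - x)) \<le> g y" if y: "y \<in> carrier_vec n" for y
  proof (cases "g y")
    case (real b)
    \<comment> \<open>\<open>w\<close> is the residual at \<open>x\<close> and \<open>e\<close> its
      rate of change towards \<open>y\<close>.\<close>
    define w e where "w = C *\<^sub>v x + q" and "e = C *\<^sub>v (y - x)"
    have we: "w \<in> carrier_vec m" "e \<in> carrier_vec m"
      using C x y q by (auto simp: w_def e_def)
    have adj: "(C\<^sup>T *\<^sub>v v) \<bullet> k = v \<bullet> (C *\<^sub>v k)" if "v \<in> carrier_vec m" "k \<in> carrier_vec n" for v k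
      using transpose_vec_mult_scalar[OF C that(2,1)] that C
      by (metis comm_scalar_prod mult_mat_vec_carrier transpose_carrier_mat)
    have u_eq: "?u \<bullet> (y - x) = s \<bullet> e - \<rho> * (w \<bullet> e)"
      using adj[of "s - \<rho> \<cdot>\<^sub>v w" "y - x"] s we x y
      by (simp add: w_def[symmetric] e_def[symmetric] minus_scalar_prod_distrib)
    have "a + ?u \<bullet> (y - x) \<le> b + t * (\<rho> / 2 * (e \<bullet> e))" if t: "0 < t" "t < 1" for t
    proof -
      define p where "p = (1 - t) \<cdot>\<^sub>v x + t \<cdot>\<^sub>v y"
      have p: "p \<in> carrier_vec n" using x y by (simp add: p_def)
      have p_eq: "p = x + t \<cdot>\<^sub>v (y - x)"
        using x y by (intro eq_vecI) (auto simp: p_def algebra_simps)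
      have Cp: "C *\<^sub>v p + q = w + t \<cdot>\<^sub>v e"
        unfolding p_eq using C x y q we
        by (intro eq_vecI)
          (auto simp: w_def e_def mult_add_distrib_mat_vec[OF C] mult_mat_vec[OF C])
      have "g p \<le> ereal (1 - t) * g x + ereal t * g y"
        using convex x y t by (simp add: convex_fun_def p_def)
      then have gp: "g p \<le> ereal ((1 - t) * a + t * b)" by (simp add: a real)
      have "ereal (a + h x) \<le> g p + ereal (h p)" using le[OF p] by (simp add: a)
      also have "\<dots> \<le> ereal ((1 - t) * a + t * b) + ereal (h p)"
        using gp by (rule add_right_mono)
      finally have ineq: "a + h x \<le> (1 - t) * a + t * b + h p" by simp
      have "(C\<^sup>T *\<^sub>v s) \<bullet> p = (C\<^sup>T *\<^sub>v s) \<bullet> x + t * (s \<bullet> e)"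
        unfolding p_eq using C s x y adj[OF s, of "y - x"]
        by (simp add: scalar_prod_add_distrib[of _ n] e_def)
      moreover have "(w + t \<cdot>\<^sub>v e) \<bullet> (w + t \<cdot>\<^sub>v e) = w \<bullet> w + 2 * t * (w \<bullet> e) + t * t * (e \<bullet> e)"
        using we by (simp add: scalar_prod_add_distrib[of _ m] add_scalar_prod_distrib[of _ m]
            comm_scalar_prod[of e m w] algebra_simps)
      ultimately have "h p = h x - t * (s \<bullet> e) + \<rho> / 2 * (2 * t * (w \<bullet> e) + t * t * (e \<bullet> e))"
        by (simp add: h_def vnorm_sq Cp w_def[symmetric] algebra_simps)
      \<comment> \<open>The common factor \<open>t\<close> is cancelled next; the quadratic
        remainder keeps one more \<open>t\<close> and vanishes in the limit.\<close>
      with ineq have "t * (a + s \<bullet> e - \<rho> * (w \<bullet> e)) \<le> t * (b + t * (\<rho> / 2 * (e \<bullet> e)))"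
        by (simp add: algebra_simps)
      then show ?thesis using t by (simp add: u_eq)
    qed
    then have "a + ?u \<bullet> (y - x) \<le> b" by (rule le_of_le_add_small_mult)
    then show ?thesis by (simp add: a real)
  qed (use proper y in \<open>auto simp: proper_fun_def\<close>)
  then show ?thesis using x u by (simp add: subdiff_def a)
qed

text \<open>A vector splits into \<open>(v + P v)/2\<close>, fixed by \<open>P\<close>, and
  \<open>(v - P v)/2\<close>, orthogonal to all fixed vectors. The normal cone of a subspace is its
  orthogonal complement, so the first part is the resolvent value.\<close>

lemma reflected_resolvent_T2_op:
  assumes P: "P \<in> carrier_mat n n" and sym: "P\<^sup>T = P"
    and inv: "\<And>v. v \<in> carrier_vec n \<Longrightarrow> P *\<^sub>v (P *\<^sub>v v) = v"
    and rho: "\<rho> > 0" and v: "v \<in> carrier_vec n"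
  shows "reflected_resolvent (T2_op P) \<rho> `` {v} = {P *\<^sub>v v}"
proof -
  \<comment> \<open>The factor \<open>1/(2*\<rho>)\<close> makes
    \<open>w + \<rho> u = v\<close>.\<close>
  define w u where "w = (1/2) \<cdot>\<^sub>v (v + P *\<^sub>v v)" and "u = (1/(2*\<rho>)) \<cdot>\<^sub>v (v - P *\<^sub>v v)"
  let ?K = "mat_kernel (1\<^sub>m n - P)"
  have Pv: "P *\<^sub>v v \<in> carrier_vec n" using P v by simp
  have wu: "w \<in> carrier_vec n" "u \<in> carrier_vec n" using Pv v by (auto simp: w_def u_def)
  have K: "y \<in> ?K \<longleftrightarrow> y \<in> carrier_vec n \<and> P *\<^sub>v y = y" for y
  proof -
    have "y - P *\<^sub>v y = 0\<^sub>v n \<longleftrightarrow> P *\<^sub>v y = y" if y: "y \<in> carrier_vec n"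
    proof
      assume *: "y - P *\<^sub>v y = 0\<^sub>v n"
      have "(y - P *\<^sub>v y) $ i = 0" if "i < n" for i using that by (simp add: *)
      then show "P *\<^sub>v y = y" using y P by (intro eq_vecI) auto
    qed (use y in simp)
    then show ?thesis using P by (auto simp: mat_kernel_def minus_mult_distrib_mat_vec[of _ n n])
  qed
  have "P *\<^sub>v w = w"
    using P v Pv by (simp add: w_def mult_mat_vec[OF P] mult_add_distrib_mat_vec[OF P] inv comm_add_vec[of v])
  then have w: "w \<in> ?K" using wu K by simp
  have orth: "u \<bullet> y = 0" if "y \<in> ?K" for y
  proof -
    have y: "y \<in> carrier_vec n" "P *\<^sub>v y = y" using that K by auto
    have "(P *\<^sub>v v) \<bullet> y = v \<bullet> y"
      using transpose_vec_mult_scalar[OF P y(1) v] sym y v Pv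
      by (metis comm_scalar_prod)
    then show ?thesis using y v Pv by (simp add: u_def minus_scalar_prod_distrib[of _ n] smult_scalar_prod_distrib[of _ n])
  qed
  \<comment> \<open>Off the kernel the indicator is infinite; on it, \<open>u\<close> is orthogonal
    to \<open>y - w\<close>, so the subgradient inequality reads \<open>0 \<le> 0\<close>.\<close>
  have "(w, u) \<in> T2_op P"
    using P wu w orth by (auto simp: T2_op_def subdiff_def indicator_fun_def scalar_prod_minus_distrib[of _ n] K)
  moreover have "w + \<rho> \<cdot>\<^sub>v u = v"
    using rho v P by (intro eq_vecI) (auto simp: w_def u_def field_simps)
  ultimately have res: "(v, w) \<in> resolvent (T2_op P) \<rho>"
    by (auto simp: resolvent_def)
  have "monotone_op n (T2_op P)"
    using P monotone_op_subdiff by (auto simp: T2_op_def)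
  then have "resolvent (T2_op P) \<rho> `` {v} = {w}"
    using res rho by (blast dest: resolvent_unique)
  then have "reflected_resolvent (T2_op P) \<rho> `` {v} = {2 \<cdot>\<^sub>v w - v}"
    by (simp add: reflected_resolvent_Image)
  also have "2 \<cdot>\<^sub>v w - v = P *\<^sub>v v"
    using v P by (intro eq_vecI) (auto simp: w_def field_simps)
  finally show ?thesis .
qed

section \<open>The network objects\<close>

text \<open>With \<open>-\<infinity>\<close> excluded, the sum is either infinite because some block
  value is, or a sum of reals; the convexity proof splits along this line.\<close>

lemma network_fun_infinite:
  assumes "\<And>i. i \<in> {1..N} \<Longrightarrow> f i (node_block N M x i) \<noteq> -\<infinity>"
  shows "network_fun N M f x \<noteq> -\<infinity>"
    and "network_fun N M f x = \<infinity> \<longleftrightarrow> (\<exists>i\<in>{1..N}. f i (node_block N M x i) = \<infinity>)"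
proof -
  have "(\<Sum>i\<in>B. f i (node_block N M x i)) \<noteq> -\<infinity>" if "finite B" "B \<subseteq> {1..N}" for B
    using that assms by (induction B) auto
  then show "network_fun N M f x \<noteq> -\<infinity>" by (simp add: network_fun_def)
qed (simp add: network_fun_def sum_Pinfty)

lemma node_block_carrier: "node_block N M x i \<in> carrier_vec (M i)"
  by (simp add: node_block_def)

lemma position_node_coords_less:
  assumes "i \<in> {1..N}" "m < M i"
  shows "position (node_coords N M) (i, m) < dim_V N M"
  using position_props(1)[OF distinct_node_coords, of "(i, m)" N M] assms
  by (simp add: set_node_coords length_node_coords)

lemma node_block_lincomb:
  assumes "x \<in> carrier_vec (dim_V N M)" "y \<in> carrier_vec (dim_V N M)" "i \<in> {1..N}"
  shows "node_block N M (a \<cdot>\<^sub>v x + c \<cdot>\<^sub>v y) i = a \<cdot>\<^sub>v node_block N M x i + c \<cdot>\<^sub>v node_block N M y i"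
  using assms position_node_coords_less[OF assms(3), of _ M]
  by (intro eq_vecI) (auto simp: node_block_def)

lemma proper_network_fun:
  assumes "\<And>i. i \<in> {1..N} \<Longrightarrow> proper_fun (M i) (f i)"
  shows "proper_fun (dim_V N M) (network_fun N M f)"
proof -
  obtain w where w: "\<And>i. i \<in> {1..N} \<Longrightarrow> w i \<in> carrier_vec (M i)" "\<And>i. i \<in> {1..N} \<Longrightarrow> f i (w i) \<noteq> \<infinity>"
    using assms unfolding proper_fun_def by metis
  have fin: "f i (node_block N M x i) \<noteq> -\<infinity>" if "i \<in> {1..N}" for x i
    using assms[OF that] node_block_carrier by (auto simp: proper_fun_def)
  \<comment> \<open>The block points are glued: coordinate \<open>r\<close> takes the component
    named by entry \<open>r\<close> of \<open>node_coords\<close>.\<close>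
  define x where "x = vec (dim_V N M) (\<lambda>r. case node_coords N M ! r of (i, m) \<Rightarrow> w i $ m)"
  have "node_block N M x i = w i" if i: "i \<in> {1..N}" for i
  proof (rule eq_vecI)
    fix m assume "m < dim_vec (w i)"
    then have m: "m < M i" using w(1)[OF i] by simp
    then show "node_block N M x i $ m = w i $ m"
      using position_props(2)[OF distinct_node_coords, of "(i, m)" N M] i
        position_node_coords_less[of i N m M] m by (simp add: node_block_def x_def set_node_coords)
  qed (use w(1)[OF i] in \<open>simp add: node_block_def\<close>)
  then have "network_fun N M f x \<noteq> \<infinity>" using network_fun_infinite(2)[of N f M x] fin w(2) by metis
  moreover have "x \<in> carrier_vec (dim_V N M)" by (simp add: x_def)
  ultimately show ?thesis
    using network_fun_infinite(1)[of N f M] fin by (auto simp: proper_fun_def)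
qed

lemma convex_network_fun:
  assumes proper: "\<And>i. i \<in> {1..N} \<Longrightarrow> proper_fun (M i) (f i)"
    and convex: "\<And>i. i \<in> {1..N} \<Longrightarrow> convex_fun (M i) (f i)"
  shows "convex_fun (dim_V N M) (network_fun N M f)"
  unfolding convex_fun_def
proof (intro ballI allI impI)
  fix x y :: "real vec" and t :: real
  assume x: "x \<in> carrier_vec (dim_V N M)" and y: "y \<in> carrier_vec (dim_V N M)" and t: "0 < t \<and> t < 1"
  let ?F = "network_fun N M f"
  have fin: "f i (node_block N M v i) \<noteq> -\<infinity>" if "i \<in> {1..N}" for v i
    using proper[OF that] node_block_carrier by (auto simp: proper_fun_def)
  have nm: "?F v \<noteq> -\<infinity>" for v using fin by (rule network_fun_infinite(1))
  show "?F ((1 - t) \<cdot>\<^sub>v x + t \<cdot>\<^sub>v y) \<le> ereal (1 - t) * ?F x + ereal t * ?F y"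
  proof (cases "?F x = \<infinity> \<or> ?F y = \<infinity>")
    case True
    \<comment> \<open>Both weights are positive and neither value is \<open>-\<infinity>\<close>, so
      one infinite value makes the whole right-hand side infinite.\<close>
    then have "ereal (1 - t) * ?F x + ereal t * ?F y = \<infinity>"
      using nm[of x] nm[of y] t by (cases "?F x"; cases "?F y") auto
    then show ?thesis by (simp only: ereal_less_eq(1))
  next
    case False
    \<comment> \<open>\<open>real_of_ereal\<close> sends infinities to 0, so \<open>r v i\<close> is
      used only for \<open>v\<close> with finite total value.\<close>
    define r where "r v i = real_of_ereal (f i (node_block N M v i))" for v i
    have r: "f i (node_block N M v i) = ereal (r v i)" if "i \<in> {1..N}" "?F v \<noteq> \<infinity>" for v i
      using fin[OF that(1), of v] that network_fun_infinite(2)[of N f M v] fin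
      by (cases "f i (node_block N M v i)") (auto simp: r_def)
    have F: "?F v = ereal (\<Sum>i\<in>{1..N}. r v i)" if "?F v \<noteq> \<infinity>" for v
      unfolding network_fun_def using r[OF _ that] by simp
    have "?F ((1 - t) \<cdot>\<^sub>v x + t \<cdot>\<^sub>v y)
        = (\<Sum>i\<in>{1..N}. f i ((1 - t) \<cdot>\<^sub>v node_block N M x i + t \<cdot>\<^sub>v node_block N M y i))"
      unfolding network_fun_def using x y by (simp add: node_block_lincomb)
    also have "\<dots> \<le> (\<Sum>i\<in>{1..N}. ereal ((1 - t) * r x i + t * r y i))"
    proof (rule sum_mono)
      fix i assume i: "i \<in> {1..N}"
      have "f i ((1 - t) \<cdot>\<^sub>v node_block N M x i + t \<cdot>\<^sub>v node_block N M y i)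
          \<le> ereal (1 - t) * f i (node_block N M x i) + ereal t * f i (node_block N M y i)"
        using convex[OF i] t node_block_carrier unfolding convex_fun_def by blast
      then show "f i ((1 - t) \<cdot>\<^sub>v node_block N M x i + t \<cdot>\<^sub>v node_block N M y i)
          \<le> ereal ((1 - t) * r x i + t * r y i)"
        using r[OF i] False by simp
    qed
    also have "\<dots> = ereal (1 - t) * ?F x + ereal t * ?F y"
      using False by (simp add: F sum.distrib sum_distrib_left)
    finally show ?thesis .
  qed
qed

text \<open>Every coordinate of a stacked edge vector lies in some edge block, so identities for
  \<open>P\<close> can be checked block by block.\<close>

lemma eq_vec_edge_blockI:
  assumes E: "E \<subseteq> {1..N} \<times> {1..N}"
    and v: "v \<in> carrier_vec (dim_E N E Me)" and w: "w \<in> carrier_vec (dim_E N E Me)"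
    and eq: "\<And>i j. (i, j) \<in> E \<Longrightarrow> edge_block N E Me v i j = edge_block N E Me w i j"
  shows "v = w"
proof (rule eq_vecI)
  let ?ec = "edge_coords N E Me"
  fix r assume "r < dim_vec w"
  then have r: "r < length ?ec" using w by (simp add: length_edge_coords[OF E])
  obtain i j m where ijm: "?ec ! r = (i, j, m)" by (cases "?ec ! r") auto
  then have mem: "(i, j) \<in> E" "m < Me i j"
    using nth_mem[OF r] by (auto simp: set_edge_coords[OF E])
  have pos: "position ?ec (i, j, m) = r"
    using position_nth[OF distinct_edge_coords r] ijm by simp
  have "edge_block N E Me v i j $ m = edge_block N E Me w i j $ m" using eq mem by simp
  then show "v $ r = w $ r" using mem pos by (simp add: edge_block_def)
qed (use v w in simp)

section \<open>Symmetry and involutivity of \<open>P\<close>, and invariance of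
  \<open>d\<close>\<close>

lemma transpose_P_mat: "(P_mat N E Me)\<^sup>T = P_mat N E Me"
  by (rule eq_matI) (auto simp: P_mat_def split: prod.splits)

text \<open>Reversing an edge twice restores it; symmetry of \<open>E\<close> and of
  \<open>Me\<close> makes the reversed block exist with the same dimension.\<close>

lemma P_mat_involution:
  assumes E: "E \<subseteq> {1..N} \<times> {1..N}" "sym E" and Me: "\<And>i j. (i, j) \<in> E \<Longrightarrow> Me i j = Me j i"
    and v: "v \<in> carrier_vec (dim_E N E Me)"
  shows "P_mat N E Me *\<^sub>v (P_mat N E Me *\<^sub>v v) = v"
proof (rule eq_vec_edge_blockI[OF E(1) _ v])
  have Pv: "P_mat N E Me *\<^sub>v v \<in> carrier_vec (dim_E N E Me)" by (intro carrier_vecI) (simp add: P_mat_def)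
  then show "P_mat N E Me *\<^sub>v (P_mat N E Me *\<^sub>v v) \<in> carrier_vec (dim_E N E Me)"
    by (intro carrier_vecI) (simp add: P_mat_def)
  fix i j assume ij: "(i, j) \<in> E"
  then have ji: "(j, i) \<in> E" using E(2) by (rule symD[rotated])
  show "edge_block N E Me (P_mat N E Me *\<^sub>v (P_mat N E Me *\<^sub>v v)) i j = edge_block N E Me v i j"
    using edge_block_P_mat[OF E(1) ij ji Me[OF ij] Pv] edge_block_P_mat[OF E(1) ji ij Me[OF ji] v]
    by simp
qed

text \<open>Block \<open>i|j\<close> of \<open>d\<close> is half of \<open>b i j\<close>, which is
  unchanged under edge reversal.\<close>

lemma P_mat_d_vec:
  assumes E: "E \<subseteq> {1..N} \<times> {1..N}" "sym E" and Me: "\<And>i j. (i, j) \<in> E \<Longrightarrow> Me i j = Me j i"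
    and b: "\<And>i j. (i, j) \<in> E \<Longrightarrow> b i j \<in> carrier_vec (Me i j)"
    and b_sym: "\<And>i j. (i, j) \<in> E \<Longrightarrow> b i j = b j i"
  shows "P_mat N E Me *\<^sub>v d_vec N E Me b = d_vec N E Me b"
proof (rule eq_vec_edge_blockI[OF E(1)])
  show d: "d_vec N E Me b \<in> carrier_vec (dim_E N E Me)" by (simp add: d_vec_def)
  then show "P_mat N E Me *\<^sub>v d_vec N E Me b \<in> carrier_vec (dim_E N E Me)"
    by (intro carrier_vecI) (simp add: P_mat_def)
  fix i j assume ij: "(i, j) \<in> E"
  then have ji: "(j, i) \<in> E" using E(2) by (rule symD[rotated])
  show "edge_block N E Me (P_mat N E Me *\<^sub>v d_vec N E Me b) i j = edge_block N E Me (d_vec N E Me b) i j"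
    using edge_block_P_mat[OF E(1) ij ji Me[OF ij] d]
      edge_block_d_vec[where b = b and Me = Me, OF E(1) ij b[OF ij]]
      edge_block_d_vec[where b = b and Me = Me, OF E(1) ji b[OF ji]] b_sym[OF ij] by simp
qed

text \<open>Operators are relations, so each equation is stated as an image of \<open>{z k}\<close>
  being a singleton, which asserts both existence and uniqueness of the value. \<open>O\<close>
  applies its left factor first, hence the reflected resolvent of \<open>T1\<close> stands on the
  left.\<close>

theorem mainTheorem4:
  fixes N :: nat and E :: "(nat \<times> nat) set"
    and M :: "nat \<Rightarrow> nat" and Me :: "nat \<Rightarrow> nat \<Rightarrow> nat"
    and fs :: "nat \<Rightarrow> real vec \<Rightarrow> ereal"
    and A :: "nat \<Rightarrow> nat \<Rightarrow> real mat" and b :: "nat \<Rightarrow> nat \<Rightarrow> real vec"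
    and f :: "real vec \<Rightarrow> ereal" and C P :: "real mat" and d :: "real vec"
    and T1 T2 :: operator and \<rho> :: real
    and x lam z :: "nat \<Rightarrow> real vec"
  assumes graph: "E \<subseteq> {1..N} \<times> {1..N}" "sym E"
    and fs: "\<And>i. i \<in> {1..N} \<Longrightarrow> fs i \<in> Gamma0 (M i)"
    and Me_sym: "\<And>i j. (i, j) \<in> E \<Longrightarrow> Me i j = Me j i"
    and A: "\<And>i j. (i, j) \<in> E \<Longrightarrow> A i j \<in> carrier_mat (Me i j) (M i)"
    and b: "\<And>i j. (i, j) \<in> E \<Longrightarrow> b i j \<in> carrier_vec (Me i j)"
    and b_sym: "\<And>i j. (i, j) \<in> E \<Longrightarrow> b i j = b j i"
    and f_eq: "f = network_fun N M fs"
    and C_eq: "C = C_mat N E M Me A"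
    and d_eq: "d = d_vec N E Me b"
    and P_eq: "P = P_mat N E Me"
    and T1_eq: "T1 = T1_op f C d"
    and T2_eq: "T2 = T2_op P"
    and rho: "\<rho> > 0"
    and T1_max: "maximal_monotone (dim_E N E Me) T1"
    and lam_0: "lam 0 \<in> carrier_vec (dim_E N E Me)"
    and x_0: "x 0 \<in> carrier_vec (dim_V N M)"
    and x_step: "\<And>k. is_arg_min
        (\<lambda>y. f y - ereal ((C\<^sup>T *\<^sub>v (P *\<^sub>v lam k)) \<bullet> y)
           + ereal (\<rho> / 2 * (vnorm (C *\<^sub>v y + P *\<^sub>v (C *\<^sub>v x k) - 2 \<cdot>\<^sub>v d))\<^sup>2))
        (\<lambda>y. y \<in> carrier_vec (dim_V N M)) (x (Suc k))"
    and lam_step: "\<And>k. lam (Suc k) =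
        P *\<^sub>v lam k - \<rho> \<cdot>\<^sub>v (C *\<^sub>v x (Suc k) + P *\<^sub>v (C *\<^sub>v x k) - 2 \<cdot>\<^sub>v d)"
    and z_eq: "\<And>k. z k = P *\<^sub>v (lam k - \<rho> \<cdot>\<^sub>v (C *\<^sub>v x k - d))"
  shows "\<forall>k. (reflected_resolvent T1 \<rho> O reflected_resolvent T2 \<rho>) `` {z k} = {z (Suc k)} \<and>
             resolvent T1 \<rho> `` {z k} = {lam (Suc k)}"
proof
  fix k
  let ?m = "dim_E N E Me" and ?n = "dim_V N M"
  have C: "C \<in> carrier_mat ?m ?n" by (simp add: C_eq C_mat_def)
  have P: "P \<in> carrier_mat ?m ?m" by (simp add: P_eq P_mat_def)
  have d: "d \<in> carrier_vec ?m" by (simp add: d_eq d_vec_def)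
  have PP: "\<And>v. v \<in> carrier_vec ?m \<Longrightarrow> P *\<^sub>v (P *\<^sub>v v) = v"
    unfolding P_eq by (rule P_mat_involution[OF graph Me_sym])
  have Pd: "P *\<^sub>v d = d"
    unfolding P_eq d_eq by (rule P_mat_d_vec[OF graph Me_sym b b_sym])
  have xc: "x k \<in> carrier_vec ?n" for k
    using x_0 x_step by (cases k) (auto simp: is_arg_min_def)
  have Cx: "C *\<^sub>v x k \<in> carrier_vec ?m" for k using C xc by simp
  have lc: "lam k \<in> carrier_vec ?m" for k
  proof (cases k)
    case (Suc j)
    have "lam (Suc j) \<in> carrier_vec ?m"
      unfolding lam_step using P d Cx by (intro carrier_vecI) simp
    then show ?thesis using Suc by simp
  qed (use lam_0 in simp)
  have PC: "P *\<^sub>v (C *\<^sub>v x k) \<in> carrier_vec ?m" and Pl: "P *\<^sub>v lam k \<in> carrier_vec ?m"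
    using P Cx lc by simp_all
  \<comment> \<open>\<open>q\<close> collects the part of the penalty that does not involve the
    minimisation variable, bringing the update into the form of
    \<open>subdiff_of_penalised_arg_min\<close> with \<open>s = P lam k\<close>.\<close>
  define q where "q = P *\<^sub>v (C *\<^sub>v x k) - 2 \<cdot>\<^sub>v d"
  have q: "q \<in> carrier_vec ?m" using PC d by (simp add: q_def)
  have q_assoc: "C *\<^sub>v y + P *\<^sub>v (C *\<^sub>v x k) - 2 \<cdot>\<^sub>v d = C *\<^sub>v y + q" for y
    using C P d by (intro eq_vecI) (auto simp: q_def)
  have proper: "proper_fun ?n f" and convex: "convex_fun ?n f"
    unfolding f_eq using fs
    by (auto simp: Gamma0_def intro!: proper_network_fun convex_network_fun)
  have l_step: "lam (Suc k) = P *\<^sub>v lam k - \<rho> \<cdot>\<^sub>v (C *\<^sub>v x (Suc k) + q)"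
    using lam_step[of k] by (simp add: q_assoc)
  have "(x (Suc k), C\<^sup>T *\<^sub>v lam (Suc k)) \<in> subdiff ?n f"
    unfolding l_step
    by (rule subdiff_of_penalised_arg_min[OF proper convex C Pl q])
      (use x_step[of k] in \<open>simp add: q_assoc\<close>)
  then have T1: "(lam (Suc k), C *\<^sub>v x (Suc k) - d) \<in> T1"
    unfolding T1_eq T1_op_def using C lc subdiff_fenchel_conj by fastforce
  have "z k = P *\<^sub>v lam k - \<rho> \<cdot>\<^sub>v (P *\<^sub>v (C *\<^sub>v x k) - d)"
    using P lc[of k] Cx[of k] d
    by (simp add: z_eq mult_minus_distrib_mat_vec[OF P] mult_mat_vec[OF P] Pd)
  \<comment> \<open>The terms in \<open>C x (Suc k)\<close> cancel, and one of the two copies of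
    \<open>d\<close> in \<open>q\<close> is absorbed by the shift \<open>- d\<close> in
    \<open>T1\<close>.\<close>
  also have "\<dots> = lam (Suc k) + \<rho> \<cdot>\<^sub>v (C *\<^sub>v x (Suc k) - d)"
    unfolding l_step q_def using Pl Cx[of "Suc k"] PC d C P
    by (intro eq_vecI) (auto simp: algebra_simps)
  finally have zk: "z k = lam (Suc k) + \<rho> \<cdot>\<^sub>v (C *\<^sub>v x (Suc k) - d)" .
  have "(z k, lam (Suc k)) \<in> resolvent T1 \<rho>"
    using T1 zk by (auto simp: resolvent_def)
  moreover have "monotone_op ?m T1" using T1_max by (simp add: maximal_monotone_def)
  ultimately have J1: "resolvent T1 \<rho> `` {z k} = {lam (Suc k)}"
    using rho by (blast dest: resolvent_unique)
  then have R1: "reflected_resolvent T1 \<rho> `` {z k} = {2 \<cdot>\<^sub>v lam (Suc k) - z k}"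
    by (simp add: reflected_resolvent_Image)
  \<comment> \<open>Reflection flips the sign of the term added to \<open>lam (Suc k)\<close>;
    applying \<open>P\<close> to the result yields \<open>z (Suc k)\<close> by
    \<open>z_eq\<close>.\<close>
  have v: "2 \<cdot>\<^sub>v lam (Suc k) - z k = lam (Suc k) - \<rho> \<cdot>\<^sub>v (C *\<^sub>v x (Suc k) - d)"
    unfolding zk using lc[of "Suc k"] Cx[of "Suc k"] d C
    by (intro eq_vecI) (auto simp: algebra_simps)
  have vc: "2 \<cdot>\<^sub>v lam (Suc k) - z k \<in> carrier_vec ?m"
    unfolding v using lc[of "Suc k"] Cx[of "Suc k"] d by simp
  have R2: "reflected_resolvent T2 \<rho> `` {2 \<cdot>\<^sub>v lam (Suc k) - z k} = {z (Suc k)}"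
    unfolding T2_eq
    using reflected_resolvent_T2_op[OF P _ PP rho vc] transpose_P_mat
    by (simp add: P_eq z_eq[of "Suc k"] v)
  show "(reflected_resolvent T1 \<rho> O reflected_resolvent T2 \<rho>) `` {z k} = {z (Suc k)} \<and>
      resolvent T1 \<rho> `` {z k} = {lam (Suc k)}"
    using J1 R1 R2 by (simp add: relcomp_Image)
qed

end
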